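(* Let $n=2k$, where $k$ is an integer. For $k\geq 2$, the distance spectral radius of the complement $\overline{C_n(1,k)}$ of the circulant graph $C_n(1,k)$ is $$\rho(\overline{C_n(1,k)})=n+2.$$
   Context: For $S\subseteq\mathbb{Z}_n\setminus\{0\}$, the circulant graph $C_n(S)$ is the simple undirected graph with vertex set $\mathbb{Z}_n=\{0,1,\ldots,n-1\}$ and edge set $\{\{g,s+g\}: g\in\mathbb{Z}_n, s\in S\}$ (addition mod $n$); $C_n(1,k)$ means $C_n(\{1,k\})$. $\overline{\Gamma}$ denotes the complement of $\Gamma$. For a graph $\Gamma$ with vertices $v_1,\ldots,v_n$, the distance matrix $\mathbf{D}(\Gamma)$ is the $n\times n$ matrix whose $(i,j)$-entry is $d_{\Gamma}(v_i,v_j)$, the length of a shortest path between $v_i$ and $v_j$, if $v_i\neq v_j$, and $0$ otherwise. The distance spectral radius $\rho(\Gamma)$ is the largest eigenvalue of $\mathbf{D}(\Gamma)$.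
   Formalization: The complement is additionally assumed connected, since for k=2 (complement edgeless) and k=3 (complement two disjoint triangles) some distances, hence the distance matrix, are undefined; for every k≥4 the complement is connected, so only these two cases are excluded. *)

theory Defs
  imports
    "Graph_Theory.Graph_Theory"
    "Jordan_Normal_Form.Char_Poly"
begin

(* Undirected simple graphs are the symmetric loop-free digraphs of Graph_Theory (locale pair_graph):
   the edge {u, v} is the pair of arcs (u, v), (v, u).  Z_n is {0..<n} with addition mod n. *)

definition circulant_graph :: "nat \<Rightarrow> nat set \<Rightarrow> nat pair_pre_digraph" where
  "circulant_graph n S =
     \<lparr> pverts = {0..<n},
       parcs = (\<Union>g\<in>{0..<n}. \<Union>s\<in>S. {(g, (s + g) mod n), ((s + g) mod n, g)}) \<rparr>"

definition complement_graph :: "'a pair_pre_digraph \<Rightarrow> 'a pair_pre_digraph" where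
  "complement_graph G =
     \<lparr> pverts = pverts G,
       parcs = {(u, v). u \<in> pverts G \<and> v \<in> pverts G \<and> u \<noteq> v \<and> (u, v) \<notin> parcs G} \<rparr>"

lemma pair_graph_circulant_graph:
  assumes "S \<subseteq> {0..<n} - {0}"
  shows "pair_graph (circulant_graph n S)"
proof -
  have no_fix: "(s + g) mod n \<noteq> g" if "s \<in> S" "g < n" for s g
  proof
    assume eq: "(s + g) mod n = g"
    have s: "0 < s" "s < n" using assms that by auto
    show False
    proof (cases "s + g < n")
      case True
      then show False using eq s by simp
    next
      case False
      then have "(s + g) mod n = s + g - n"
        using s that by (simp add: mod_if)
      then show False using eq s that False by linarith
    qed
  qed
  have no_fix': "g \<noteq> (s + g) mod n" if "s \<in> S" "g < n" for s g
    using no_fix[OF that] by metis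
  have "finite S" using assms by (rule finite_subset) simp
  then show ?thesis
    using no_fix no_fix'
    by unfold_locales
      (auto simp: circulant_graph_def symmetric_def intro!: symI)
qed

lemma pair_graph_complement_graph:
  assumes "pair_graph G"
  shows "pair_graph (complement_graph G)"
proof -
  interpret pair_graph G by fact
  have "finite (pverts G \<times> pverts G)" using pair_finite_verts by simp
  then have fin: "finite (parcs (complement_graph G))"
    by (rule rev_finite_subset) (auto simp: complement_graph_def)
  have "sym (parcs G)" using pair_sym_arcs by (simp add: symmetric_def)
  then have "sym (parcs (complement_graph G))"
    by (auto simp: complement_graph_def sym_def)
  then show ?thesis
    using fin pair_finite_verts
    by unfold_locales (auto simp: complement_graph_def symmetric_def)
qed

(* The length of a shortest path.  Only meaningful if v is reachable from u. *)
definition graph_dist :: "('a, 'b) pre_digraph \<Rightarrow> 'a \<Rightarrow> 'a \<Rightarrow> nat" where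
  "graph_dist G u v = (LEAST l. \<exists>p. pre_digraph.apath G u p v \<and> length p = l)"

(* Vertices are enumerated in increasing order. *)
definition distance_matrix :: "('a :: linorder, 'b) pre_digraph \<Rightarrow> real mat" where
  "distance_matrix G =
     (let vs = sorted_list_of_set (verts G)
      in mat (length vs) (length vs)
           (\<lambda>(i, j). if vs ! i \<noteq> vs ! j then real (graph_dist G (vs ! i) (vs ! j)) else 0))"

(* The distance matrix of a connected undirected graph is real symmetric, so all its eigenvalues
   are real and the maximum is over a finite nonempty set. *)
definition distance_spectral_radius :: "('a :: linorder, 'b) pre_digraph \<Rightarrow> real" where
  "distance_spectral_radius G = Max {e. eigenvalue (distance_matrix G) e}"

end

theory Submission
  imports Defs
begin

text \<open>
  The circulant graph \<open>C\<^sub>2\<^sub>k(1,k)\<close> is the cycle with all its diameters (the Moebius ladder), and it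
  is cubic, since \<open>k\<close> is its own negative.  In the complement each vertex \<open>u\<close> therefore has exactly
  three other vertices at distance greater than one: the neighbours of \<open>u\<close> in the ladder.

  For \<open>k \<ge> 4\<close> these three are at distance exactly two.  If \<open>u\<close> and \<open>v\<close> are adjacent in the ladder,
  each belongs to the three-element neighbourhood of the other, so the two closed neighbourhoods
  together cover at most six of the \<open>2k \<ge> 8\<close> vertices; any remaining vertex is a common
  neighbour in the complement.  Every row of the distance matrix thus has sum
  \<open>(n - 1) + 3 = n + 2\<close>: a one for every other vertex and an additional one for every ladder
  neighbour.  The constant row sum of a nonnegative matrix is its largest eigenvalue, attained by the
  all-ones vector.

  The cases \<open>k = 2\<close> and \<open>k = 3\<close> contradict connectedness.  There the ladder is \<open>K\<^sub>4\<close> and \<open>K\<^sub>3\<^sub>,\<^sub>3\<close>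
  respectively, and the complement consists of isolated vertices or of two triangles.
\<close>

section \<open>Nonnegative matrices with constant row sums\<close>

text \<open>
  The all-ones vector shows that \<open>r\<close> is an eigenvalue.  Conversely, in a row where an eigenvector has
  an entry of maximal modulus \<open>m\<close>, the eigenvalue equation and the triangle inequality give
  \<open>\<bar>e\<bar> * m \<le> r * m\<close>, so no eigenvalue exceeds \<open>r\<close>.
\<close>

lemma Max_eigenvalue_constant_row_sum:
  fixes A :: "real mat"
  assumes A: "A \<in> carrier_mat n n" and "n > 0"
    and nonneg: "\<And>i j. i < n \<Longrightarrow> j < n \<Longrightarrow> A $$ (i, j) \<ge> 0"
    and row_sum: "\<And>i. i < n \<Longrightarrow> (\<Sum>j<n. A $$ (i, j)) = r"
  shows "Max {e. eigenvalue A e} = r"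
proof -
  have mult: "(A *\<^sub>v x) $ i = (\<Sum>j<n. A $$ (i, j) * x $ j)" if "x \<in> carrier_vec n" "i < n" for x i
    using A that by (simp add: scalar_prod_def atLeast0LessThan)
  show ?thesis
  proof (rule Max_eqI)
    have "char_poly A \<noteq> 0"
      using degree_monic_char_poly[OF A] by auto
    then show "finite {e. eigenvalue A e}"
      using poly_roots_finite by (simp add: eigenvalue_root_char_poly[OF A])
    let ?one = "vec n (\<lambda>_. 1 :: real)"
    have "A *\<^sub>v ?one = r \<cdot>\<^sub>v ?one"
      using A row_sum by (intro eq_vecI) (simp_all add: mult del: index_mult_mat_vec)
    moreover have "?one \<noteq> 0\<^sub>v n"
      using \<open>n > 0\<close> by (metis index_vec index_zero_vec(1) zero_neq_one)
    ultimately show "r \<in> {e. eigenvalue A e}"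
      using A unfolding eigenvalue_def eigenvector_def by (auto intro!: exI[of _ ?one])
  next
    fix e assume "e \<in> {e. eigenvalue A e}"
    then obtain x where x: "x \<in> carrier_vec n" "x \<noteq> 0\<^sub>v n" and eig: "A *\<^sub>v x = e \<cdot>\<^sub>v x"
      using A unfolding eigenvalue_def eigenvector_def by auto
    define m where "m = Max ((\<lambda>j. \<bar>x $ j\<bar>) ` {..<n})"
    have le_m: "\<bar>x $ j\<bar> \<le> m" if "j < n" for j
      unfolding m_def using that by (intro Max_ge) auto
    have "m \<in> (\<lambda>j. \<bar>x $ j\<bar>) ` {..<n}"
      unfolding m_def using \<open>n > 0\<close> by (intro Max_in) auto
    then obtain i where i: "i < n" "\<bar>x $ i\<bar> = m" by auto
    obtain j where "j < n" "x $ j \<noteq> 0"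
      using x by (metis carrier_vecD eq_vecI index_zero_vec)
    then have "m > 0" using le_m[of j] by linarith
    have "e * x $ i = (\<Sum>j<n. A $$ (i, j) * x $ j)"
      using A x i arg_cong[OF eig, of "\<lambda>v. v $ i"] mult[OF x(1) i(1)] by simp
    then have "\<bar>e\<bar> * m = \<bar>\<Sum>j<n. A $$ (i, j) * x $ j\<bar>"
      using i by (metis abs_mult)
    also have "\<dots> \<le> (\<Sum>j<n. \<bar>A $$ (i, j) * x $ j\<bar>)"
      by (rule sum_abs)
    also have "\<dots> \<le> (\<Sum>j<n. A $$ (i, j) * m)"
      using i nonneg le_m by (intro sum_mono) (auto simp: abs_mult intro!: mult_left_mono)
    also have "\<dots> = r * m"
      using row_sum i by (simp add: sum_distrib_right[symmetric])
    finally show "e \<le> r" using \<open>m > 0\<close> by simp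
  qed
qed

section \<open>Graphs of diameter at most two\<close>

lemma graph_dist_adjacent:
  fixes G :: "'a pair_pre_digraph"
  assumes "u \<in> pverts G" "v \<in> pverts G" "u \<noteq> v" "(u, v) \<in> parcs G"
  shows "graph_dist G u v = 1"
  unfolding graph_dist_def
proof (rule Least_equality)
  have "pre_digraph.apath G u [(u, v)] v"
    using assms by (simp add: pre_digraph.apath_def pre_digraph.awalk_def pre_digraph.cas.simps
        pre_digraph.awalk_verts.simps)
  then show "\<exists>p. pre_digraph.apath G u p v \<and> length p = 1"
    by (intro exI[of _ "[(u, v)]"]) simp
next
  fix l assume "\<exists>p. pre_digraph.apath G u p v \<and> length p = l"
  then show "1 \<le> l"
    using \<open>u \<noteq> v\<close> by (cases l) (auto simp: pre_digraph.apath_def pre_digraph.awalk_def pre_digraph.cas.simps)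
qed

lemma graph_dist_common_neighbour:
  fixes G :: "'a pair_pre_digraph"
  assumes "pair_graph G" and "u \<noteq> v" "(u, v) \<notin> parcs G"
    and w: "(u, w) \<in> parcs G" "(w, v) \<in> parcs G"
  shows "graph_dist G u v = 2"
  unfolding graph_dist_def
proof (rule Least_equality)
  interpret pair_graph G by fact
  have "u \<noteq> w" "w \<noteq> v" "u \<in> pverts G"
    using w assms(3) by (auto dest: in_arcsD1)
  then have "pre_digraph.apath G u [(u, w), (w, v)] v"
    using assms by (simp add: pre_digraph.apath_def pre_digraph.awalk_def pre_digraph.cas.simps
        pre_digraph.awalk_verts.simps)
  then show "\<exists>p. pre_digraph.apath G u p v \<and> length p = 2"
    by (intro exI[of _ "[(u, w), (w, v)]"]) simp
next
  fix l assume "\<exists>p. pre_digraph.apath G u p v \<and> length p = l"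
  then obtain p where p: "set p \<subseteq> parcs G" "pre_digraph.cas G u p v" "length p = l"
    by (auto simp: pre_digraph.apath_def pre_digraph.awalk_def)
  show "2 \<le> l"
  proof (rule ccontr)
    assume "\<not> 2 \<le> l"
    then have "p = [] \<or> (\<exists>a. p = [a])" using p(3)
      by (cases p; cases "tl p") auto
    then show False
      using p assms(2,3) by (auto simp: pre_digraph.cas.simps)
  qed
qed

text \<open>
  When nonadjacent vertices always have a common neighbour, the entry of the distance matrix at two
  distinct vertices is one, plus another one if they are not adjacent.  If every vertex has the same
  number \<open>c\<close> of non-neighbours, the row sums are constant.
\<close>

lemma distance_spectral_radius_diameter_2:
  fixes G :: "'a :: linorder pair_pre_digraph"
  assumes G: "pair_graph G" and nonempty: "pverts G \<noteq> {}"
    and coregular: "\<And>u. u \<in> pverts G \<Longrightarrow> card {v \<in> pverts G. v \<noteq> u \<and> (u, v) \<notin> parcs G} = c"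
    and common: "\<And>u v. u \<in> pverts G \<Longrightarrow> v \<in> pverts G \<Longrightarrow> u \<noteq> v \<Longrightarrow> (u, v) \<notin> parcs G \<Longrightarrow>
      \<exists>w. (u, w) \<in> parcs G \<and> (w, v) \<in> parcs G"
  shows "distance_spectral_radius G = real (card (pverts G)) - 1 + real c"
proof -
  interpret pair_graph G by fact
  define V where "V = pverts G"
  define vs where "vs = sorted_list_of_set V"
  define n where "n = length vs"
  define d where "d u v = (if u \<noteq> v then real (graph_dist G u v) else 0)" for u v
  have fin: "finite V" unfolding V_def by simp
  have n: "n = card V" and bij: "bij_betw ((!) vs) {..<n} V"
    unfolding n_def vs_def using fin
    by (simp_all add: bij_betw_nth)
  have dist: "distance_matrix G = mat n n (\<lambda>(i, j). d (vs ! i) (vs ! j))"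
    unfolding distance_matrix_def n_def vs_def V_def d_def by (simp add: Let_def cong: if_cong)
  have d: "d u v = of_bool (v \<noteq> u) + of_bool (v \<noteq> u \<and> (u, v) \<notin> parcs G)" if "u \<in> V" "v \<in> V" for u v
    using that common[of u v] graph_dist_adjacent[of u G v] graph_dist_common_neighbour[OF G, of u v]
    unfolding d_def V_def by auto
  have row: "(\<Sum>v\<in>V. d u v) = real (card V) - 1 + real c" if u: "u \<in> V" for u
  proof -
    have "(\<Sum>v\<in>V. d u v)
        = (\<Sum>v\<in>V. of_bool (v \<noteq> u)) + (\<Sum>v\<in>V. of_bool (v \<noteq> u \<and> (u, v) \<notin> parcs G))"
      using d u by (simp add: sum.distrib)
    also have "(\<Sum>v\<in>V. of_bool (v \<noteq> u)) = real (card (V - {u}))"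
      using fin by (simp add: Diff_eq Collect_neg_eq[symmetric] Int_def)
    also have "(\<Sum>v\<in>V. of_bool (v \<noteq> u \<and> (u, v) \<notin> parcs G)) = real c"
      using fin coregular[of u] u by (simp add: V_def Int_def)
    also have "card (V - {u}) = card V - 1" using fin u by simp
    also have "real (card V - 1) = real (card V) - 1"
    proof -
      have "card V \<ge> 1" using fin u by (metis One_nat_def Suc_leI card_gt_0_iff empty_iff)
      then show ?thesis by (simp add: of_nat_diff)
    qed
    finally show ?thesis .
  qed
  show ?thesis
    unfolding distance_spectral_radius_def V_def[symmetric]
  proof (rule Max_eigenvalue_constant_row_sum)
    show "distance_matrix G \<in> carrier_mat n n" by (simp add: dist)
    show "n > 0" using nonempty fin by (simp add: n V_def card_gt_0_iff)
    show "distance_matrix G $$ (i, j) \<ge> 0" if "i < n" "j < n" for i j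
      using that by (simp add: dist d_def)
    show "(\<Sum>j<n. distance_matrix G $$ (i, j)) = real (card V) - 1 + real c" if "i < n" for i
    proof -
      have "(\<Sum>j<n. distance_matrix G $$ (i, j)) = (\<Sum>j<n. d (vs ! i) (vs ! j))"
        using that by (simp add: dist)
      also have "\<dots> = (\<Sum>v\<in>V. d (vs ! i) v)"
        using bij by (rule sum.reindex_bij_betw)
      also have "\<dots> = real (card V) - 1 + real c"
        using bij that by (intro row) (auto simp: bij_betw_def)
      finally show ?thesis .
    qed
  qed
qed

section \<open>The Moebius ladder and its complement\<close>

text \<open>
  The sum and difference modulo \<open>2k\<close> are spelled out as case distinctions, so that membership and
  cardinality become questions of linear arithmetic.
\<close>

definition ladder_neighbours :: "nat \<Rightarrow> nat \<Rightarrow> nat set" where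
  "ladder_neighbours k u =
     {if u + 1 = 2 * k then 0 else u + 1,
      if u = 0 then 2 * k - 1 else u - 1,
      if u < k then u + k else u - k}"

lemma ladder_arc_iff:
  assumes "k \<ge> 2" "u < 2 * k"
  shows "(u, v) \<in> parcs (circulant_graph (2 * k) {1, k}) \<longleftrightarrow> v \<in> ladder_neighbours k u"
proof -
  have succ: "(1 + g) mod (2 * k) = (if g + 1 = 2 * k then 0 else g + 1)"
    and antipode: "(k + g) mod (2 * k) = (if g < k then g + k else g - k)" if "g < 2 * k" for g
    using that by (auto simp: mod_if)
  have "(u, v) \<in> parcs (circulant_graph (2 * k) {1, k}) \<longleftrightarrow>
      v = (1 + u) mod (2 * k) \<or> v = (k + u) mod (2 * k) \<or>
      (v < 2 * k \<and> (u = (1 + v) mod (2 * k) \<or> u = (k + v) mod (2 * k)))"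
    using assms by (auto simp: circulant_graph_def)
  also have "\<dots> \<longleftrightarrow> v \<in> ladder_neighbours k u"
    using assms succ[of u] antipode[of u] succ[of v] antipode[of v]
    unfolding ladder_neighbours_def
    by (cases "v < 2 * k") (auto split: if_splits)
  finally show ?thesis .
qed

lemma ladder_neighbours_facts:
  assumes "k \<ge> 2" "u < 2 * k"
  shows ladder_neighbours_verts: "ladder_neighbours k u \<subseteq> {0..<2 * k}"
    and ladder_neighbours_irrefl: "u \<notin> ladder_neighbours k u"
    and card_ladder_neighbours: "card (ladder_neighbours k u) = 3"
  using assms by (auto simp: ladder_neighbours_def card_insert_if split: if_splits)

lemma ladder_neighbours_sym:
  assumes "k \<ge> 2" "u < 2 * k" "v \<in> ladder_neighbours k u"
  shows "u \<in> ladder_neighbours k v"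
  using assms by (auto simp: ladder_neighbours_def split: if_splits)

lemma pverts_complement_circulant:
  "pverts (complement_graph (circulant_graph n S)) = {0..<n}"
  by (simp add: complement_graph_def circulant_graph_def)

lemma complement_ladder_arc_iff:
  assumes "k \<ge> 2"
  shows "(u, v) \<in> parcs (complement_graph (circulant_graph (2 * k) {1, k})) \<longleftrightarrow>
    u < 2 * k \<and> v < 2 * k \<and> v \<notin> insert u (ladder_neighbours k u)"
proof -
  have "(u, v) \<in> parcs (complement_graph (circulant_graph (2 * k) {1, k})) \<longleftrightarrow>
    u < 2 * k \<and> v < 2 * k \<and> u \<noteq> v \<and> (u, v) \<notin> parcs (circulant_graph (2 * k) {1, k})"
    unfolding complement_graph_def by (simp add: circulant_graph_def)
  then show ?thesis
    using ladder_arc_iff[OF assms, of u v] by auto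
qed

text \<open>
  Because \<open>u\<close> and \<open>v\<close> are neighbours, \<open>insert u (ladder_neighbours k u)\<close> and
  \<open>insert v (ladder_neighbours k v)\<close> have no elements beyond those of the two open neighbourhoods.  The
  union has at most \<open>3 + 3\<close> elements, fewer than the \<open>2k \<ge> 8\<close> vertices.
\<close>

lemma complement_ladder_common_neighbour:
  assumes k: "k \<ge> 4" and u: "u < 2 * k" and v: "v \<in> ladder_neighbours k u"
  shows "\<exists>w < 2 * k. w \<notin> insert u (ladder_neighbours k u) \<and> w \<notin> insert v (ladder_neighbours k v)"
proof -
  let ?N = "ladder_neighbours k"
  have v_lt: "v < 2 * k" and u_in: "u \<in> ?N v"
    using ladder_neighbours_verts[of k u] ladder_neighbours_sym[of k u v] assms by auto
  have fin: "finite (?N u)" "finite (?N v)" by (simp_all add: ladder_neighbours_def)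
  have "card (?N u \<union> ?N v) \<le> 6"
    using card_Un_le[of "?N u" "?N v"] card_ladder_neighbours[of k] k u v_lt by simp
  also have "6 < card {0..<2 * k}" using k by simp
  finally have "\<not> {0..<2 * k} \<subseteq> ?N u \<union> ?N v"
    using fin by (meson card_mono finite_UnI not_less)
  then show ?thesis using u_in v by auto
qed

text \<open>
  In these two cases arcs of the complement preserve parity: for \<open>k = 2\<close> there are none, and for
  \<open>k = 3\<close> the only differences left are \<open>\<plusminus>2\<close> modulo \<open>6\<close>.  Hence \<open>1\<close> cannot be reached from \<open>0\<close>.
\<close>

lemma complement_ladder_disconnected:
  assumes "k = 2 \<or> k = 3"
  shows "\<not> Digraph_Component.connected (complement_graph (circulant_graph (2 * k) {1, k}))"
proof
  define G where "G = complement_graph (circulant_graph (2 * k) {1, k})"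
  assume "Digraph_Component.connected (complement_graph (circulant_graph (2 * k) {1, k}))"
  then have conn: "Digraph_Component.connected G" by (simp only: G_def)
  interpret pair_graph G
    unfolding G_def using assms
    by (intro pair_graph_complement_graph pair_graph_circulant_graph) auto
  have parity: "even u \<longleftrightarrow> even v" if "(u, v) \<in> parcs G" for u v
  proof -
    have "u < 2 * k" "v < 2 * k" "v \<notin> insert u (ladder_neighbours k u)"
      using that complement_ladder_arc_iff[of k u v] assms unfolding G_def by auto
    moreover have "u \<in> {0, 1, 2, 3, 4, 5}" "v \<in> {0, 1, 2, 3, 4, 5}"
      using \<open>u < 2 * k\<close> \<open>v < 2 * k\<close> assms by auto
    ultimately show ?thesis
      using assms by (auto simp: ladder_neighbours_def)
  qed
  have "0 \<in> pverts G" "1 \<in> pverts G"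
    unfolding G_def pverts_complement_circulant using assms by auto
  then have "0 \<rightarrow>\<^sup>*\<^bsub>G\<^esub> 1"
    using symmetric_connected_imp_strongly_connected[OF sym_arcs conn]
    unfolding strongly_connected_def by simp
  then have "even (0 :: nat) \<longleftrightarrow> even (1 :: nat)"
    by (induction rule: reachable_induct) (auto dest: parity)
  then show False by simp
qed

theorem theorem4p1:
  fixes n k :: nat
  assumes "n = 2 * k"
    and "k \<ge> 2"
    and "Digraph_Component.connected (complement_graph (circulant_graph n {1, k}))"
  shows "distance_spectral_radius (complement_graph (circulant_graph n {1, k})) = real n + 2"
proof -
  define G where "G = complement_graph (circulant_graph n {1, k})"
  let ?N = "ladder_neighbours k"
  have "k \<noteq> 2" "k \<noteq> 3"
    using assms complement_ladder_disconnected[of k] by blast+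
  then have k: "k \<ge> 4" using \<open>k \<ge> 2\<close> by linarith
  have G: "pair_graph G"
    unfolding G_def using assms
    by (intro pair_graph_complement_graph pair_graph_circulant_graph) auto
  have verts: "pverts G = {0..<2 * k}"
    unfolding G_def pverts_complement_circulant \<open>n = 2 * k\<close> ..
  have arc: "(u, v) \<in> parcs G \<longleftrightarrow> u < 2 * k \<and> v < 2 * k \<and> v \<notin> insert u (?N u)" for u v
    unfolding G_def \<open>n = 2 * k\<close> by (rule complement_ladder_arc_iff[OF \<open>k \<ge> 2\<close>])
  have "distance_spectral_radius G = real (card (pverts G)) - 1 + real 3"
  proof (rule distance_spectral_radius_diameter_2[OF G])
    show "pverts G \<noteq> {}" using k by (simp add: verts)
  next
    fix u assume u: "u \<in> pverts G"
    then have "{v \<in> pverts G. v \<noteq> u \<and> (u, v) \<notin> parcs G} = ?N u"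
      using ladder_neighbours_facts[OF \<open>k \<ge> 2\<close>, of u] by (auto simp: verts arc)
    then show "card {v \<in> pverts G. v \<noteq> u \<and> (u, v) \<notin> parcs G} = 3"
      using card_ladder_neighbours[OF \<open>k \<ge> 2\<close>, of u] u by (simp add: verts)
  next
    fix u v assume uv: "u \<in> pverts G" "v \<in> pverts G" "u \<noteq> v" "(u, v) \<notin> parcs G"
    then have "v \<in> ?N u" by (auto simp: verts arc)
    then obtain w where w: "w < 2 * k" "w \<notin> insert u (?N u)" "w \<notin> insert v (?N v)"
      using complement_ladder_common_neighbour[OF k, of u v] uv by (auto simp: verts)
    have "v \<notin> ?N w"
      using w ladder_neighbours_sym[OF \<open>k \<ge> 2\<close>, of w v] by auto
    then show "\<exists>w. (u, w) \<in> parcs G \<and> (w, v) \<in> parcs G"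
      using uv w by (intro exI[of _ w]) (auto simp: verts arc)
  qed
  then show ?thesis
    unfolding G_def[symmetric] using \<open>n = 2 * k\<close> by (simp add: verts)
qed

end
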